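(* Let $d \ge 0$ and $k$ be integers with $1 \le k \le \lfloor \frac{d+3}{2} \rfloor$. Let $\Sigma$ be a simplicial complex on $d+3$ vertices with fewer than $\binom{d+2}{k}$ faces of dimension $k-1$. Then $\Sigma$ embeds (topologically) into the $d$-sphere $S^d$.
   Context: An embedding means a continuous injective map from the geometric realization of the simplicial complex. *)

theory Defs
  imports "HOL-Analysis.Analysis"
begin

text \<open>
  Abstract simplicial complexes on a finite vertex set \<open>V\<close>. The singletons \<open>{v}\<close> with \<open>v \<in> V\<close> are
  not required to be faces (an element of \<open>V\<close> may be a ``ghost vertex''), and it is left open
  whether the empty set is a face; the latter does not affect the geometric realization.
\<close>

definition simplicial_complex_on :: "'a set \<Rightarrow> 'a set set \<Rightarrow> bool" where
  "simplicial_complex_on V K \<longleftrightarrow>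
     finite V \<and> (\<forall>F\<in>K. F \<subseteq> V) \<and> (\<forall>F\<in>K. \<forall>G. G \<subseteq> F \<longrightarrow> G \<in> K)"

definition faces_of_dim :: "'a set set \<Rightarrow> int \<Rightarrow> 'a set set" where
  "faces_of_dim K i = {F \<in> K. int (card F) - 1 = i}"

text \<open>
  Points are given by barycentric coordinates: a point of the realization is a convex combination
  of the vertices whose support is a face. If \<open>K\<close> is a complex on a finite set \<open>V\<close>, all
  coordinates outside \<open>V\<close> vanish, so the topology below is the Euclidean one on \<open>\<real>\<^sup>V\<close>, which for a
  finite complex is the usual (weak) topology.
\<close>

definition geometric_realization :: "'a set set \<Rightarrow> ('a \<Rightarrow> real) topology" where
  "geometric_realization K =
     subtopology (powertop_real UNIV)
       {x. (\<forall>v. 0 \<le> x v) \<and> {v. x v \<noteq> 0} \<in> K \<and> (\<Sum>v | x v \<noteq> 0. x v) = 1}"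

definition topological_embedding :: "'a topology \<Rightarrow> 'b topology \<Rightarrow> ('a \<Rightarrow> 'b) \<Rightarrow> bool" where
  "topological_embedding X Y f \<longleftrightarrow> continuous_map X Y f \<and> inj_on f (topspace X)"

end

theory Submission
  imports Defs "HOL-Combinatorics.Permutations"
begin

text \<open>
  More than \<open>(d + 3 choose k) - (d + 2 choose k) = (d + 2 choose (k - 1))\<close> of the \<open>k\<close>-subsets of the
  vertex set are not faces, so by the Erdos--Ko--Rado theorem two of them, \<open>A\<close> and \<open>B\<close>, are
  disjoint. A point of the realization then has minimal coordinate \<open>0\<close> on \<open>A\<close> and on \<open>B\<close>, and is
  therefore determined by its class in \<open>\<real>\<^sup>V\<close> modulo the indicator vectors of \<open>A\<close> and \<open>B\<close>, a
  space of dimension \<open>d + 1\<close>. This class is nonzero, and normalizing it loses nothing because the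
  coordinates of the point sum to \<open>1\<close>.
\<close>

section \<open>The Erdos--Ko--Rado theorem\<close>

lemma exists_permutes_image_eq:
  assumes "finite V" "S \<subseteq> V" "T \<subseteq> V" "card S = card T"
  obtains \<sigma> where "\<sigma> permutes V" "\<sigma> ` S = T"
proof -
  have fin: "finite S" "finite T" using assms finite_subset by blast+
  obtain f where f: "bij_betw f S T"
    using assms fin finite_same_card_bij by blast
  have "card (V - S) = card (V - T)"
    using assms fin by (simp add: card_Diff_subset)
  then obtain g where g: "bij_betw g (V - S) (V - T)"
    using assms finite_same_card_bij by (metis finite_Diff)
  define \<sigma> where "\<sigma> x = (if x \<in> S then f x else if x \<in> V then g x else x)" for x
  have S: "bij_betw \<sigma> S T"
    using f by (rule bij_betw_cong [THEN iffD1, rotated]) (simp add: \<sigma>_def)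
  have "bij_betw \<sigma> (V - S) (V - T)"
    using g by (rule bij_betw_cong [THEN iffD1, rotated]) (simp add: \<sigma>_def)
  with S have "bij_betw \<sigma> (S \<union> (V - S)) (T \<union> (V - T))"
    by (rule bij_betw_combine) auto
  with assms have "bij_betw \<sigma> V V" by (simp add: Un_absorb1)
  then have "\<sigma> permutes V"
    by (rule bij_imp_permutes) (use assms in \<open>auto simp: \<sigma>_def\<close>)
  with S show thesis using that by (auto simp: bij_betw_def)
qed

lemma card_permutes_image_le:
  assumes "finite V" "T \<subseteq> V" "T' \<subseteq> V" "card T = card T'"
  shows "card {\<pi>. \<pi> permutes V \<and> \<pi> ` S = T} \<le> card {\<pi>. \<pi> permutes V \<and> \<pi> ` S = T'}"
proof -
  obtain \<sigma> where \<sigma>: "\<sigma> permutes V" "\<sigma> ` T = T'"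
    using assms exists_permutes_image_eq by metis
  show ?thesis
  proof (rule card_inj_on_le)
    show "inj_on ((\<circ>) \<sigma>) {\<pi>. \<pi> permutes V \<and> \<pi> ` S = T}"
      using permutes_inj [OF \<sigma>(1)] by (auto simp: inj_on_def fun_eq_iff inj_def)
    show "(\<circ>) \<sigma> ` {\<pi>. \<pi> permutes V \<and> \<pi> ` S = T} \<subseteq> {\<pi>. \<pi> permutes V \<and> \<pi> ` S = T'}"
      using \<sigma> by (auto simp: permutes_compose image_comp [symmetric])
    show "finite {\<pi>. \<pi> permutes V \<and> \<pi> ` S = T'}"
      using finite_permutations [OF assms(1)] by (rule finite_subset [rotated]) auto
  qed
qed

text \<open>A uniformly random permutation sends \<open>S\<close> to a uniformly random subset of
  the same size; this is the probability of landing in \<open>\<F>\<close>, with denominators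
  cleared.\<close>

lemma card_permutes_image_mem:
  assumes "finite V" "S \<subseteq> V" and \<F>: "\<F> \<subseteq> {T. T \<subseteq> V \<and> card T = card S}"
  shows "(card V choose card S) * card {\<pi>. \<pi> permutes V \<and> \<pi> ` S \<in> \<F>} = card \<F> * fact (card V)"
proof -
  define N where "N = card {\<pi>. \<pi> permutes V \<and> \<pi> ` S = S}"
  have N: "card {\<pi>. \<pi> permutes V \<and> \<pi> ` S = T} = N" if "T \<subseteq> V" "card T = card S" for T
    unfolding N_def using that assms(1,2) by (intro antisym card_permutes_image_le) auto
  have count: "card {\<pi>. \<pi> permutes V \<and> \<pi> ` S \<in> \<G>} = card \<G> * N"
    if \<G>: "\<G> \<subseteq> {T. T \<subseteq> V \<and> card T = card S}" for \<G>
  proof -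
    have "finite \<G>" using \<G> assms(1) by (auto intro: finite_subset [of _ "Pow V"])
    moreover have "finite {\<pi>. \<pi> permutes V \<and> \<pi> ` S = T}" for T
      using finite_permutations [OF assms(1)] by (rule finite_subset [rotated]) auto
    ultimately have "card (\<Union>T\<in>\<G>. {\<pi>. \<pi> permutes V \<and> \<pi> ` S = T}) =
        (\<Sum>T\<in>\<G>. card {\<pi>. \<pi> permutes V \<and> \<pi> ` S = T})"
      by (intro card_UN_disjoint) auto
    also have "\<dots> = (\<Sum>T\<in>\<G>. N)"
      by (intro sum.cong refl N) (use \<G> in auto)
    finally have "card (\<Union>T\<in>\<G>. {\<pi>. \<pi> permutes V \<and> \<pi> ` S = T}) = card \<G> * N" by simp
    moreover have "(\<Union>T\<in>\<G>. {\<pi>. \<pi> permutes V \<and> \<pi> ` S = T}) = {\<pi>. \<pi> permutes V \<and> \<pi> ` S \<in> \<G>}"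
      by auto
    ultimately show ?thesis by simp
  qed
  \<comment> \<open>Counting with the family of all subsets of size \<open>card S\<close> evaluates
    the common fibre size \<open>N\<close>.\<close>
  have "{\<pi>. \<pi> permutes V} = {\<pi>. \<pi> permutes V \<and> \<pi> ` S \<in> {T. T \<subseteq> V \<and> card T = card S}}"
    using assms(2) by (auto simp: permutes_in_image permutes_inj_on card_image)
  then have "fact (card V) = (card V choose card S) * N"
    using count [OF subset_refl] card_permutations [OF refl assms(1)] n_subsets [OF assms(1)]
    by simp
  with count [OF \<F>] show ?thesis by simp
qed

lemma card_mult_card_le_by_permutations:
  assumes "finite V" "finite I" "\<And>i. i \<in> I \<Longrightarrow> A i \<subseteq> V \<and> card (A i) = k"
    and "\<F> \<subseteq> {T. T \<subseteq> V \<and> card T = k}"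
    and m: "\<And>\<pi>. \<pi> permutes V \<Longrightarrow> card {i \<in> I. \<pi> ` A i \<in> \<F>} \<le> m"
  shows "card I * card \<F> \<le> m * (card V choose k)"
proof -
  let ?P = "{\<pi>. \<pi> permutes V}"
  have fin: "finite ?P" by (rule finite_permutations [OF assms(1)])
  have "card I * card \<F> * fact (card V) =
      (\<Sum>i\<in>I. (card V choose k) * card {\<pi>. \<pi> permutes V \<and> \<pi> ` A i \<in> \<F>})"
  proof -
    have "(card V choose k) * card {\<pi>. \<pi> permutes V \<and> \<pi> ` A i \<in> \<F>} = card \<F> * fact (card V)"
      if "i \<in> I" for i
      using card_permutes_image_mem [of V "A i" \<F>] assms that by simp
    then show ?thesis by simp
  qed
  also have "\<dots> = (card V choose k) * (\<Sum>i\<in>I. card {\<pi> \<in> ?P. \<pi> ` A i \<in> \<F>})"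
    by (simp add: sum_distrib_left)
  also have "(\<Sum>i\<in>I. card {\<pi> \<in> ?P. \<pi> ` A i \<in> \<F>}) = (\<Sum>\<pi>\<in>?P. card {i \<in> I. \<pi> ` A i \<in> \<F>})"
    by (rule sum_multicount_gen) (use fin assms(2) in auto)
  also have "\<dots> \<le> card ?P * m"
    by (rule sum_bounded_above [THEN order_trans]) (use m in auto)
  also have "card ?P = fact (card V)" by (simp add: card_permutations assms(1))
  finally have "(card I * card \<F>) * fact (card V) \<le> (m * (card V choose k)) * fact (card V)"
    by (simp add: mult_ac)
  then show ?thesis by simp
qed

section \<open>Arcs of consecutive residues modulo \<open>n\<close>\<close>

definition arc :: "int \<Rightarrow> int \<Rightarrow> int \<Rightarrow> int set" where
  "arc n k i = (\<lambda>j. (i + j) mod n) ` {0..<k}"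

lemma arc_subset: "n > 0 \<Longrightarrow> arc n k i \<subseteq> {0..<n}"
  by (auto simp: arc_def)

lemma card_arc:
  assumes "k \<le> n"
  shows "card (arc n k i) = nat k"
proof -
  have "inj_on (\<lambda>j. (i + j) mod n) {0..<k}"
  proof
    fix j j' assume j: "j \<in> {0..<k}" "j' \<in> {0..<k}" "(i + j) mod n = (i + j') mod n"
    then have "n dvd j - j'" by (simp add: mod_eq_dvd_iff)
    moreover have "\<bar>j - j'\<bar> < \<bar>n\<bar>" using j assms by auto
    ultimately show "j = j'" using dvd_imp_le_int [of "j - j'" n] by linarith
  qed
  then show ?thesis by (simp add: arc_def card_image)
qed

text \<open>A common point has offsets \<open>j\<close> and \<open>j'\<close> in the two arcs, both
  from 0 to \<open>k - 1\<close>; \<open>t\<close> is their difference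
  \<open>j' - j\<close>.\<close>

lemma arcs_meetE:
  assumes "arc n k i \<inter> arc n k i' \<noteq> {}"
  obtains t where "-k < t" "t < k" "n dvd i - i' - t"
proof -
  obtain j j' where j: "j \<in> {0..<k}" "j' \<in> {0..<k}" "(i + j) mod n = (i' + j') mod n"
    using assms unfolding arc_def by blast
  then have "n dvd i - i' - (j' - j)" by (simp add: mod_eq_dvd_iff algebra_simps)
  with j that [of "j' - j"] show thesis by auto
qed

text \<open>
  Katona's lemma. Relative to a fixed member \<open>i0\<close>, the starting points lie at positions \<open>0\<close>,
  \<open>1, \<dots>, k - 1\<close> or \<open>n - k + 1, \<dots>, n - 1\<close>, and since \<open>2 * k \<le> n\<close> the arcs at \<open>r\<close> and \<open>r + n - k\<close>
  are disjoint.
\<close>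

lemma card_intersecting_arcs_le:
  fixes n k :: int
  assumes "0 < k" "2 * k \<le> n" and I: "I \<subseteq> {0..<n}"
    and meet: "\<And>i i'. i \<in> I \<Longrightarrow> i' \<in> I \<Longrightarrow> arc n k i \<inter> arc n k i' \<noteq> {}"
  shows "card I \<le> nat k"
proof (cases "I = {}")
  case False
  then obtain i0 where i0: "i0 \<in> I" by blast
  define r where "r i = (i - i0) mod n" for i
  \<comment> \<open>\<open>g\<close> folds the upper window of positions onto 1 up to
    \<open>k - 1\<close>, giving \<open>r\<close> and \<open>r + n - k\<close> the same value, so a
    collision under \<open>g\<close> is either a forbidden pair or an equality of positions.\<close>
  define g where "g i = (if r i < k then r i else r i - (n - k))" for i
  have r_range: "0 \<le> r i" "r i < n" for i using assms by (auto simp: r_def)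
  have r_cases: "r i < k \<or> n - k < r i" if i: "i \<in> I" for i
  proof -
    obtain t where t: "-k < t" "t < k" "n dvd i - i0 - t"
      using arcs_meetE [OF meet [OF i i0]] .
    then have "r i = t mod n" by (simp add: r_def mod_eq_dvd_iff)
    moreover have "t mod n = (if 0 \<le> t then t else t + n)"
    proof (cases "0 \<le> t")
      case False
      then have "(t + n) mod n = t + n" using t assms by (intro mod_pos_pos_trivial) auto
      then show ?thesis using False by simp
    qed (use t assms in auto)
    ultimately show ?thesis using t by auto
  qed
  have no_pair: "r i' \<noteq> r i + (n - k)" if ii: "i \<in> I" "i' \<in> I" for i i'
  proof
    assume eq: "r i' = r i + (n - k)"
    obtain t where t: "-k < t" "t < k" "n dvd i - i' - t"
      using arcs_meetE [OF meet [OF ii]] .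
    have r: "n dvd (i - i0) - r i" "n dvd (i' - i0) - r i'"
      by (simp_all add: r_def)
    \<comment> \<open>The starting points cancel, and by \<open>eq\<close> the sum equals
      \<open>k - t\<close>. This lies strictly between 0 and \<open>2 * k \<le> n\<close>, so it is
      not a multiple of \<open>n\<close>.\<close>
    have "n dvd (i - i' - t) - ((i - i0) - r i) + ((i' - i0) - r i') + n"
      by (rule dvd_add [OF dvd_add [OF dvd_diff [OF t(3) r(1)] r(2)] dvd_refl])
    then have "n dvd k - t" by (simp add: eq)
    moreover have "0 < k - t" "k - t < n" using t assms by auto
    ultimately show False using zdvd_imp_le [of n "k - t"] by linarith
  qed
  have "inj_on g I"
  proof
    fix i i' assume ii: "i \<in> I" "i' \<in> I" "g i = g i'"
    then have "r i = r i'"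
      using no_pair [of i i'] no_pair [of i' i] by (auto simp: g_def split: if_splits)
    then have "n dvd i - i'" by (simp add: r_def mod_eq_dvd_iff)
    moreover have "i \<in> {0..<n}" "i' \<in> {0..<n}" using ii I by auto
    then have "\<bar>i - i'\<bar> < \<bar>n\<bar>" by auto
    ultimately show "i = i'" using dvd_imp_le_int [of "i - i'" n] by linarith
  qed
  moreover have "g ` I \<subseteq> {0..<k}"
    using r_cases r_range by (fastforce simp: g_def)
  ultimately have "card I \<le> card {0..<k}" by (rule card_inj_on_le) simp
  then show ?thesis by simp
qed simp

text \<open>Katona's cycle argument: \<open>e\<close> places \<open>V\<close> on a cycle with
  \<open>n\<close> arcs. Under every permutation at most \<open>k\<close> of the arcs land in
  \<open>\<F>\<close>, since those that do meet pairwise. Averaging and the absorption identity for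
  binomials give the bound after cancelling \<open>n\<close>.\<close>

theorem Erdos_Ko_Rado:
  assumes "finite V" "0 < k" "2 * k \<le> card V"
    and \<F>: "\<F> \<subseteq> {T. T \<subseteq> V \<and> card T = k}"
    and meet: "\<And>A B. A \<in> \<F> \<Longrightarrow> B \<in> \<F> \<Longrightarrow> A \<inter> B \<noteq> {}"
  shows "card \<F> \<le> (card V - 1) choose (k - 1)"
proof -
  define n where "n = card V"
  have "card {0..<int n} = card V" by (simp add: n_def)
  then obtain e where e: "bij_betw e {0..<int n} V"
    using assms(1) finite_same_card_bij by blast
  have n: "int n > 0" using assms by (simp add: n_def)
  have sub: "arc n k i \<subseteq> {0..<int n}" for i by (rule arc_subset [OF n])
  have inj: "inj_on e {0..<int n}" and im: "e ` {0..<int n} = V"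
    using e by (auto simp: bij_betw_def)
  have arcs: "e ` arc n k i \<subseteq> V \<and> card (e ` arc n k i) = k" for i
  proof
    show "e ` arc n k i \<subseteq> V" using sub im by blast
    have "card (e ` arc n k i) = card (arc n k i)"
      using inj_on_subset [OF inj sub] by (rule card_image)
    also have "\<dots> = k" using assms by (subst card_arc) (auto simp: n_def)
    finally show "card (e ` arc n k i) = k" .
  qed
  have bound: "card {i \<in> {0..<int n}. \<pi> ` e ` arc n k i \<in> \<F>} \<le> k" if \<pi>: "\<pi> permutes V" for \<pi>
  proof -
    have "card {i \<in> {0..<int n}. \<pi> ` e ` arc n k i \<in> \<F>} \<le> nat (int k)"
    proof (rule card_intersecting_arcs_le)
      fix i i' assume "i \<in> {i \<in> {0..<int n}. \<pi> ` e ` arc n k i \<in> \<F>}"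
        "i' \<in> {i \<in> {0..<int n}. \<pi> ` e ` arc n k i \<in> \<F>}"
      then have "(\<pi> ` e ` arc n k i) \<inter> (\<pi> ` e ` arc n k i') \<noteq> {}" using meet by blast
      then have "e ` arc n k i \<inter> e ` arc n k i' \<noteq> {}"
        by (simp add: image_Int [OF permutes_inj [OF \<pi>], symmetric])
      then show "arc n k i \<inter> arc n k i' \<noteq> {}"
        using inj_on_image_Int [OF inj sub sub] by (metis image_empty)
    qed (use assms in \<open>auto simp: n_def\<close>)
    then show ?thesis by simp
  qed
  have "card {0..<int n} * card \<F> \<le> k * (card V choose k)"
    using assms(1) arcs \<F> bound
    by (intro card_mult_card_le_by_permutations [where V = V and A = "\<lambda>i. e ` arc n k i"]) auto
  also have "\<dots> = n * ((n - 1) choose (k - 1))"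
    using times_binomial_minus1_eq [OF assms(2)] by (simp add: n_def)
  finally show ?thesis using n by (simp add: n_def)
qed

section \<open>Embedding a complex with two disjoint non-faces\<close>

text \<open>Both \<open>x\<close> and \<open>y\<close> have minimum 0 on \<open>A\<close>, so
  comparing the minima of \<open>x - s\<close> and \<open>c * (y - t)\<close> there forces
  \<open>s = c * t\<close>.\<close>

lemma scaled_on_set_if_differences_scaled:
  fixes x y :: "'a \<Rightarrow> real"
  assumes "c > 0" "\<And>v. v \<in> A \<Longrightarrow> 0 \<le> x v" "\<And>v. v \<in> A \<Longrightarrow> 0 \<le> y v"
    and "\<exists>v\<in>A. x v = 0" "\<exists>v\<in>A. y v = 0"
    and diff: "\<And>v. v \<in> A \<Longrightarrow> x v - s = c * (y v - t)"
    and "v \<in> A"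
  shows "x v = c * y v"
proof -
  obtain u w where u: "u \<in> A" "x u = 0" and w: "w \<in> A" "y w = 0" using assms by blast
  have "0 \<le> c * y u" "0 \<le> x w" using assms u w by auto
  moreover have "- s = c * y u - c * t" "x w - s = - c * t"
    using diff [OF u(1)] diff [OF w(1)] u w by (simp_all add: algebra_simps)
  ultimately have "s = c * t" by linarith
  with diff [OF assms(7)] show ?thesis by (simp add: algebra_simps)
qed

lemma topological_embedding_of_disjoint_nonfaces:
  fixes V :: "'a set"
  assumes K: "simplicial_complex_on V K" and V: "card V = d + 3"
    and AB: "A \<subseteq> V" "B \<subseteq> V" "A \<noteq> {}" "B \<noteq> {}" "A \<inter> B = {}" "A \<notin> K" "B \<notin> K"
  shows "\<exists>f. topological_embedding (geometric_realization K) (nsphere d) f"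
proof -
  define X where "X = {x :: 'a \<Rightarrow> real. (\<forall>v. 0 \<le> x v) \<and> {v. x v \<noteq> 0} \<in> K \<and> (\<Sum>v | x v \<noteq> 0. x v) = 1}"
  have fin: "finite V" using K by (simp add: simplicial_complex_on_def)
  obtain a b where ab: "a \<in> A" "b \<in> B" using AB by blast
  have "card (V - {a, b}) = d + 1"
    using ab AB V fin by (subst card_Diff_subset) (auto simp: card_insert_if)
  then obtain e where e: "bij_betw e {..d} (V - {a, b})"
    using fin finite_same_card_bij [of "{..d}" "V - {a, b}"] by auto
  \<comment> \<open>The representative of \<open>x\<close> modulo the indicators of \<open>A\<close>
    and \<open>B\<close> whose coordinates at \<open>a\<close> and \<open>b\<close> vanish. The
    other \<open>d + 1\<close> vertices, enumerated by \<open>e\<close>, give coordinates on the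
    quotient.\<close>
  define p :: "('a \<Rightarrow> real) \<Rightarrow> 'a \<Rightarrow> real"
    where "p x v = x v - (if v \<in> A then x a else if v \<in> B then x b else 0)" for x v
  define N where "N x = sqrt (\<Sum>i\<le>d. (p x (e i))\<^sup>2)" for x
  \<comment> \<open>Points of \<open>nsphere d\<close> are sequences vanishing beyond index
    \<open>d\<close>, hence the default 0.\<close>
  define f where "f x i = (if i \<le> d then p x (e i) / N x else 0)" for x i

  have pab: "p x a = 0" "p x b = 0" for x using ab AB by (auto simp: p_def)
  have nonneg: "0 \<le> x v" if "x \<in> X" for x v using that by (simp add: X_def)
  have outside: "x v = 0" if "x \<in> X" "v \<notin> V" for x v
    using that K by (auto simp: X_def simplicial_complex_on_def)
  have sum1: "(\<Sum>v\<in>V. x v) = 1" if "x \<in> X" for x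
  proof -
    have "(\<Sum>v\<in>V. x v) = (\<Sum>v | x v \<noteq> 0. x v)"
      using outside [OF that] fin by (intro sum.mono_neutral_right) auto
    with that show ?thesis by (simp add: X_def)
  qed
  \<comment> \<open>Otherwise the support of \<open>x\<close> would contain \<open>C\<close>, making
    \<open>C\<close> a face by downward closure.\<close>
  have zero: "\<exists>v\<in>C. x v = 0" if "x \<in> X" "C \<notin> K" for x C
  proof (rule ccontr)
    assume "\<not> (\<exists>v\<in>C. x v = 0)"
    then have "C \<subseteq> {v. x v \<noteq> 0}" by blast
    with that K show False by (auto simp: X_def simplicial_complex_on_def)
  qed
  \<comment> \<open>The factor \<open>c\<close> allows for normalization; it is recovered as 1 from
    the coordinate sums.\<close>
  have p_inj: "x = y" if xy: "x \<in> X" "y \<in> X" and c: "c > 0"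
    and eq: "\<And>i. i \<le> d \<Longrightarrow> p x (e i) = c * p y (e i)" for x y c
  proof -
    have eqV: "p x v = c * p y v" if "v \<in> V" for v
    proof (cases "v \<in> {a, b}")
      case False
      with e that obtain i where "i \<le> d" "v = e i" by (auto simp: bij_betw_def)
      with eq show ?thesis by simp
    qed (auto simp: pab)
    have "x v = c * y v" if "v \<in> V" for v
    proof -
      consider "v \<in> A" | "v \<in> B" | "v \<notin> A" "v \<notin> B" by blast
      then show ?thesis
      proof cases
        case 1
        show ?thesis
        proof (rule scaled_on_set_if_differences_scaled [of c A x y "x a" "y a"])
          fix w assume "w \<in> A"
          then show "x w - x a = c * (y w - y a)" using eqV [of w] AB by (auto simp: p_def)
        qed (use 1 c xy AB nonneg zero in auto)
      next
        case 2
        show ?thesis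
        proof (rule scaled_on_set_if_differences_scaled [of c B x y "x b" "y b"])
          fix w assume "w \<in> B"
          moreover from this have "w \<notin> A" "w \<in> V" using AB by auto
          ultimately show "x w - x b = c * (y w - y b)" using eqV [of w] by (simp add: p_def)
        qed (use 2 c xy AB nonneg zero in auto)
      next
        case 3
        with eqV [OF that] show ?thesis by (simp add: p_def)
      qed
    qed
    then have scaled: "x v = c * y v" for v
      using outside [OF xy(1)] outside [OF xy(2)] by (cases "v \<in> V") auto
    then have "(\<Sum>v\<in>V. x v) = c * (\<Sum>v\<in>V. y v)" by (simp add: sum_distrib_left)
    then have "c = 1" using sum1 xy by simp
    with scaled show ?thesis by auto
  qed
  \<comment> \<open>If the class of \<open>x\<close> were zero, \<open>x\<close> would be constant
    on \<open>A\<close> and on \<open>B\<close> and zero elsewhere; its zeros in \<open>A\<close>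
    and \<open>B\<close> would then make it vanish, against the sum 1.\<close>
  have Npos: "N x > 0" if x: "x \<in> X" for x
  proof (rule ccontr)
    assume "\<not> N x > 0"
    then have "(\<Sum>i\<le>d. (p x (e i))\<^sup>2) \<le> 0" by (simp add: N_def)
    then have "(\<Sum>i\<le>d. (p x (e i))\<^sup>2) = 0" by (intro antisym sum_nonneg) auto
    then have p0: "p x (e i) = 0" if "i \<le> d" for i
      using that by (subst (asm) sum_nonneg_eq_0_iff) auto
    have eqV: "p x v = 0" if "v \<in> V" for v
    proof (cases "v \<in> {a, b}")
      case False
      with e that obtain i where "i \<le> d" "v = e i" by (auto simp: bij_betw_def)
      with p0 show ?thesis by simp
    qed (auto simp: pab)
    have "x v = 0" if "v \<in> V" for v
    proof -
      obtain u w where u: "u \<in> A" "x u = 0" and w: "w \<in> B" "x w = 0"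
        using zero [OF x AB(6)] zero [OF x AB(7)] by metis
      then have "w \<notin> A" "u \<in> V" "w \<in> V" using AB by auto
      with u w eqV [of u] eqV [of w] have "x a = 0" "x b = 0" by (simp_all add: p_def)
      then show ?thesis using eqV [OF that] by (simp add: p_def split: if_splits)
    qed
    then show False using sum1 [OF x] by simp
  qed
  have inj: "inj_on f X"
  proof
    fix x y assume xy: "x \<in> X" "y \<in> X" "f x = f y"
    have "p x (e i) = (N x / N y) * p y (e i)" if "i \<le> d" for i
      using fun_cong [OF xy(3), of i] Npos [OF xy(1)] Npos [OF xy(2)] that
      by (simp add: f_def field_simps)
    then show "x = y" using xy Npos by (intro p_inj [of x y "N x / N y"]) auto
  qed
  let ?T = "subtopology (powertop_real UNIV) X"
  have cont_p: "continuous_map ?T euclideanreal (\<lambda>x. p x v)" for v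
  proof -
    have coord: "continuous_map ?T euclideanreal (\<lambda>x. x w)" for w
      by (intro continuous_map_from_subtopology continuous_map_product_projection) simp
    have "continuous_map ?T euclideanreal (\<lambda>x. if v \<in> A then x a else if v \<in> B then x b else 0)"
      by (simp add: coord)
    then show ?thesis unfolding p_def by (intro continuous_map_diff coord)
  qed
  have "continuous_map ?T euclideanreal (\<lambda>x. \<Sum>i\<le>d. (p x (e i))\<^sup>2)"
    unfolding power2_eq_square by (intro continuous_map_sum continuous_map_real_mult cont_p) auto
  then have "continuous_map ?T euclideanreal (sqrt \<circ> (\<lambda>x. \<Sum>i\<le>d. (p x (e i))\<^sup>2))"
    by (rule continuous_map_compose) (simp add: continuous_on_real_sqrt continuous_on_id)
  moreover have "N = sqrt \<circ> (\<lambda>x. \<Sum>i\<le>d. (p x (e i))\<^sup>2)" by (simp add: N_def fun_eq_iff)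
  ultimately have cont_N: "continuous_map ?T euclideanreal N" by simp
  have "continuous_map ?T euclideanreal (\<lambda>x. f x i)" for i
  proof (cases "i \<le> d")
    case True
    have "continuous_map ?T euclideanreal (\<lambda>x. p x (e i) / N x)"
      by (intro continuous_map_real_divide cont_p cont_N) (use Npos in force)
    with True show ?thesis by (simp add: f_def)
  qed (simp add: f_def)
  moreover have "(\<Sum>i\<le>d. (f x i)\<^sup>2) = 1" if x: "x \<in> X" for x
  proof -
    have "(\<Sum>i\<le>d. (f x i)\<^sup>2) = (\<Sum>i\<le>d. (p x (e i))\<^sup>2) / (N x)\<^sup>2"
      by (simp add: f_def power_divide sum_divide_distrib)
    also have "(N x)\<^sup>2 = (\<Sum>i\<le>d. (p x (e i))\<^sup>2)" by (simp add: N_def sum_nonneg)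
    finally show ?thesis using Npos [OF x] by (simp add: N_def)
  qed
  ultimately have "continuous_map ?T (nsphere d) f"
    by (auto simp: nsphere continuous_map_in_subtopology continuous_map_componentwise_UNIV f_def)
  with inj have "topological_embedding (geometric_realization K) (nsphere d) f"
    by (simp add: topological_embedding_def geometric_realization_def flip: X_def)
  then show ?thesis by blast
qed

theorem theorem1p3:
  fixes d k :: nat and V :: "'a set" and \<Sigma> :: "'a set set"
  assumes "1 \<le> k" and "k \<le> (d + 3) div 2"
    and "simplicial_complex_on V \<Sigma>"
    and "card V = d + 3"
    and "card (faces_of_dim \<Sigma> (int k - 1)) < (d + 2) choose k"
  shows "\<exists>f. topological_embedding (geometric_realization \<Sigma>) (nsphere d) f"
proof -
  let ?S = "{T. T \<subseteq> V \<and> card T = k}" and ?F = "faces_of_dim \<Sigma> (int k - 1)"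
  have fin: "finite V" and sub: "?F \<subseteq> ?S"
    using assms(3) by (auto simp: simplicial_complex_on_def faces_of_dim_def)
  have finS: "finite ?S" using fin by (auto intro: finite_subset [of _ "Pow V"])
  have "card (?S - ?F) = card ?S - card ?F"
    using sub finS by (intro card_Diff_subset) (auto intro: finite_subset)
  also have "card ?S = (d + 3) choose k" using n_subsets [OF fin] assms(4) by simp
  also have "(d + 3) choose k = ((d + 2) choose (k - 1)) + ((d + 2) choose k)"
    using assms(1) by (cases k) (auto simp: numeral_3_eq_3)
  finally have "card (?S - ?F) > (d + 2) choose (k - 1)" using assms(5) by simp
  then have "\<not> card (?S - ?F) \<le> (card V - 1) choose (k - 1)"
    using assms(4) by simp
  \<comment> \<open>The bound on \<open>k\<close> becomes \<open>2 * k \<le> card V\<close>, as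
    Erdos--Ko--Rado requires.\<close>
  moreover have "card (?S - ?F) \<le> (card V - 1) choose (k - 1)"
    if "\<forall>A \<in> ?S - ?F. \<forall>B \<in> ?S - ?F. A \<inter> B \<noteq> {}"
    by (rule Erdos_Ko_Rado [OF fin]) (use assms(1,2,4) that in auto)
  ultimately obtain A B where AB: "A \<in> ?S - ?F" "B \<in> ?S - ?F" "A \<inter> B = {}"
    by blast
  \<comment> \<open>A \<open>k\<close>-set outside \<open>?F\<close> has the right dimension, so it
    can only fail to be a face; it is nonempty because \<open>k \<ge> 1\<close>.\<close>
  then have "A \<notin> \<Sigma>" "B \<notin> \<Sigma>" "A \<noteq> {}" "B \<noteq> {}"
    using assms(1) by (auto simp: faces_of_dim_def)
  with AB show ?thesis
    by (intro topological_embedding_of_disjoint_nonfaces [OF assms(3,4), of A B]) auto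
qed

end
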